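(* Let $A$ be an invertible $n\times n$ complex matrix. For (linearly) independent $x,y\in\mathbb C^n$ let $\varphi$ be the angle between $x$ and $y$ and let $\psi$ be the angle between $Ax$ and $Ay$. Then \[ \kappa(A)^{-1}\tan(\varphi/2)\le\tan(\psi/2)\le \kappa(A)\tan(\varphi/2). \] Let $\lambda_n$ and $\lambda_1$ denote the smallest and largest eigenvalues of $A^*A$. Then equality holds in the right-hand inequality above if and only if $x/\|x\|+y/\|y\|$ is in the $\lambda_n$-eigenspace of $A^*A$ and $x/\|x\|-y/\|y\|$ is in the $\lambda_1$-eigenspace of $A^*A$. Also, equality holds in the left-hand inequality above if and only if $x/\|x\|-y/\|y\|$ is in the $\lambda_n$-eigenspace of $A^*A$ and $x/\|x\|+y/\|y\|$ is in the $\lambda_1$-eigenspace of $A^*A$.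
   Context: $\|x\|=\sqrt{x^*x}$ is the Euclidean norm on $\mathbb C^n$. The angle $\theta$ between non-zero vectors $x,y\in\mathbb C^n$ is defined by $0\le\theta\le\pi$ and $\cos\theta=\dfrac{\operatorname{Re}(y^*x)}{\|x\|\|y\|}$. The condition number is $\kappa(A)=\|A\|\,\|A^{-1}\|$, where $\|\cdot\|$ on matrices denotes the operator norm induced by the Euclidean norm. *)

theory Defs
  imports "HOL-Analysis.Analysis"
begin

definition cinner :: "complex ^ 'n \<Rightarrow> complex ^ 'n \<Rightarrow> complex" where
  "cinner x y = (\<Sum>i\<in>UNIV. cnj (y $ i) * x $ i)"
  \<comment> \<open>the product \<open>y\<^sup>* x\<close>, conjugate-linear in the second argument\<close>

definition angle :: "complex ^ 'n \<Rightarrow> complex ^ 'n \<Rightarrow> real" where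
  "angle x y = arccos (Re (cinner x y) / (norm x * norm y))"
  \<comment> \<open>meaningful for non-zero \<open>x\<close> and \<open>y\<close> only\<close>

definition conj_transpose :: "complex ^ 'n ^ 'm \<Rightarrow> complex ^ 'm ^ 'n" where
  "conj_transpose A = map_matrix cnj (transpose A)"

definition condition_number :: "complex ^ 'n ^ 'n \<Rightarrow> real" where
  "condition_number A = onorm ((*v) A) * onorm ((*v) (matrix_inv A))"

definition eigenspace :: "complex ^ 'n ^ 'n \<Rightarrow> complex \<Rightarrow> (complex ^ 'n) set" where
  "eigenspace M l = {v. M *v v = l *s v}"

definition eigenvalue :: "complex ^ 'n ^ 'n \<Rightarrow> complex \<Rightarrow> bool" where
  "eigenvalue M l \<longleftrightarrow> (\<exists>v. v \<noteq> 0 \<and> v \<in> eigenspace M l)"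

text \<open>
  The next two notions are intended for Hermitian matrices, such as
  \<open>conj_transpose A ** A\<close>, all of whose eigenvalues are real
  (see \<open>eigenvalue_conj_transpose_mult_real\<close> below).
\<close>

definition min_eigenvalue :: "complex ^ 'n ^ 'n \<Rightarrow> real" where
  "min_eigenvalue M = Min {r. eigenvalue M (complex_of_real r)}"

definition max_eigenvalue :: "complex ^ 'n ^ 'n \<Rightarrow> real" where
  "max_eigenvalue M = Max {r. eigenvalue M (complex_of_real r)}"

lemma cinner_self: "cinner x x = complex_of_real ((norm x)\<^sup>2)"
proof -
  have "(norm x)\<^sup>2 = (\<Sum>i\<in>UNIV. (cmod (x $ i))\<^sup>2)"
    by (simp add: norm_vec_def L2_set_def sum_nonneg)
  then show ?thesis
    by (simp add: cinner_def complex_norm_square mult.commute del: of_real_power)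
qed

lemma cinner_conj_transpose:
  "cinner (conj_transpose A *v x) y = cinner x (A *v y)"
proof -
  have "cinner (conj_transpose A *v x) y
      = (\<Sum>i\<in>UNIV. \<Sum>j\<in>UNIV. cnj (y $ i) * (cnj (A $ j $ i) * x $ j))"
    by (simp add: cinner_def conj_transpose_def matrix_vector_mult_def transpose_def
        sum_distrib_left)
  also have "\<dots> = (\<Sum>j\<in>UNIV. \<Sum>i\<in>UNIV. cnj (y $ i) * (cnj (A $ j $ i) * x $ j))"
    by (rule sum.swap)
  also have "\<dots> = cinner x (A *v y)"
    by (simp add: cinner_def matrix_vector_mult_def sum_distrib_left mult_ac)
  finally show ?thesis .
qed

lemma eigenvalue_conj_transpose_mult_real:
  assumes "eigenvalue (conj_transpose A ** A) l"
  shows "l \<in> \<real>"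
proof -
  obtain v where v: "v \<noteq> 0" "(conj_transpose A ** A) *v v = l *s v"
    using assms by (auto simp: eigenvalue_def eigenspace_def)
  have "l * cinner v v = cinner (l *s v) v"
    by (simp add: cinner_def sum_distrib_left mult_ac)
  also have "\<dots> = cinner (A *v v) (A *v v)"
    by (simp add: v(2)[symmetric] matrix_vector_mul_assoc[symmetric] cinner_conj_transpose)
  finally have "l = complex_of_real ((norm (A *v v))\<^sup>2 / (norm v)\<^sup>2)"
    using v(1) by (simp add: cinner_self field_simps)
  then show ?thesis
    by (metis Reals_of_real)
qed

end

theory Submission
  imports Defs
begin

text \<open>
  Write \<open>u = sgn x\<close>, \<open>v = sgn y\<close>; then \<open>p = u + v\<close> and \<open>q = u - v\<close> are orthogonal for the real inner
  product \<open>Re (y\<^sup>* x)\<close>, and \<open>tan (\<phi>/2) = \<parallel>q\<parallel> / \<parallel>p\<parallel>\<close>. Only this real inner product and the real-linearity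
  of \<open>A\<close> matter for the inequalities. Let \<open>M = \<parallel>A\<parallel>\<close> and \<open>m = 1 / \<parallel>A\<^sup>-\<^sup>1\<parallel>\<close> be the optimal constants in
  \<open>m \<parallel>z\<parallel> \<le> \<parallel>A z\<parallel> \<le> M \<parallel>z\<parallel>\<close>, so that \<open>\<kappa>(A) = M / m\<close>. For \<open>a = A u\<close> and \<open>b = A v\<close>,
  \[ \tan(\psi/2) = \frac{\|a\|\,\|b\| - a \cdot b}{\sqrt{\|a\|^2 \|b\|^2 - (a \cdot b)^2}} . \]
  The numerator is at most \<open>\<parallel>a - b\<parallel>\<^sup>2 / 2 = \<parallel>A q\<parallel>\<^sup>2 / 2\<close> by the arithmetic-geometric mean inequality. The
  Gram determinant under the root is a quarter of that of \<open>A p\<close> and \<open>A q\<close>, which is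
  \<open>\<parallel>A q\<parallel>\<^sup>2 \<parallel>A (p - c q)\<parallel>\<^sup>2\<close> for a suitable real \<open>c\<close>; since \<open>p\<close> and \<open>q\<close> are orthogonal, this is at least
  \<open>\<parallel>A q\<parallel>\<^sup>2 m\<^sup>2 \<parallel>p\<parallel>\<^sup>2\<close>. Therefore
  \[ \tan(\psi/2) \le \frac{\|A q\|}{m \|p\|} \le \frac{M \|q\|}{m \|p\|} = \kappa(A) \tan(\varphi/2) \]
  (\<open>tan_half_angle_linear_image_le\<close>). Equality forces \<open>c = 0\<close>, \<open>\<parallel>A q\<parallel> = M \<parallel>q\<parallel>\<close> and \<open>\<parallel>A p\<parallel> = m \<parallel>p\<parallel>\<close>; the
  converse holds because vectors at which \<open>\<parallel>A z\<parallel> / \<parallel>z\<parallel>\<close> is extremal are critical points, whence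
  \<open>A p \<bullet> A q = m\<^sup>2 (p \<bullet> q) = 0\<close> (\<open>tan_half_angle_linear_image_eq_iff\<close>).

  The same criticality shows that \<open>\<parallel>A z\<parallel> = M \<parallel>z\<parallel>\<close> characterises the eigenspace of \<open>A\<^sup>* A\<close> for \<open>M\<^sup>2\<close>,
  the largest eigenvalue, and likewise for \<open>m\<close> and the smallest eigenvalue. The left-hand inequality,
  with its equality case, is the right-hand one for \<open>x\<close> and \<open>-y\<close>: replacing \<open>y\<close> by \<open>-y\<close> interchanges \<open>p\<close>
  and \<open>q\<close> and turns both half-angles into their complements, so that the tangents are inverted.
\<close>

section \<open>Half-angles in real inner product spaces\<close>

text \<open>The tangent of half the angle between two vectors; meaningful for non-zero vectors only.\<close>

definition tan_half_angle :: "'a::real_inner \<Rightarrow> 'a \<Rightarrow> real" where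
  "tan_half_angle a b = tan (arccos (a \<bullet> b / (norm a * norm b)) / 2)"

text \<open>The Gram determinant, which is the squared area of the parallelogram spanned by \<open>a\<close> and \<open>b\<close>.\<close>

definition gram_det :: "'a::real_inner \<Rightarrow> 'a \<Rightarrow> real" where
  "gram_det a b = (a \<bullet> a) * (b \<bullet> b) - (a \<bullet> b)\<^sup>2"

text \<open>The second factor on the right is the length of the component of \<open>a\<close> orthogonal to \<open>b\<close>.\<close>

lemma gram_det_projection:
  assumes "b \<noteq> 0"
  shows "gram_det a b = (norm b * norm (a - (a \<bullet> b / (b \<bullet> b)) *\<^sub>R b))\<^sup>2"
proof -
  define c where "c = a \<bullet> b / (b \<bullet> b)"
  have c: "c * (b \<bullet> b) = a \<bullet> b"
    using assms by (simp add: c_def)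
  have "(norm (a - c *\<^sub>R b))\<^sup>2 = a \<bullet> a - 2 * c * (a \<bullet> b) + c * (c * (b \<bullet> b))"
    by (simp add: power2_norm_eq_inner inner_diff inner_commute algebra_simps)
  also have "\<dots> = a \<bullet> a - c * (a \<bullet> b)"
    by (simp add: c)
  finally have n: "(norm (a - c *\<^sub>R b))\<^sup>2 = a \<bullet> a - c * (a \<bullet> b)" .
  have "(norm b * norm (a - c *\<^sub>R b))\<^sup>2 = (b \<bullet> b) * (a \<bullet> a) - (c * (b \<bullet> b)) * (a \<bullet> b)"
    by (simp only: power_mult_distrib n power2_norm_eq_inner[of b]) (simp add: algebra_simps)
  then show ?thesis
    by (simp add: c gram_det_def power2_eq_square c_def[symmetric])
qed

lemma gram_det_sum_diff: "gram_det (a + b) (a - b) = 4 * gram_det a b"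
  by (simp add: gram_det_def inner_add inner_diff inner_commute power2_eq_square algebra_simps)

lemma tan_half_angle_eq:
  assumes "gram_det a b > 0"
  shows "tan_half_angle a b = (norm a * norm b - a \<bullet> b) / sqrt (gram_det a b)"
proof -
  define N where "N = norm a * norm b"
  define c where "c = a \<bullet> b / N"
  have "a \<noteq> 0" "b \<noteq> 0"
    using assms by (auto simp: gram_det_def)
  then have N: "N > 0"
    by (simp add: N_def)
  have ab: "a \<bullet> b = N * c"
    using N by (simp add: c_def)
  have D: "gram_det a b = N\<^sup>2 * (1 - c\<^sup>2)"
    by (simp add: gram_det_def ab power_mult_distrib right_diff_distrib)
      (simp add: N_def power_mult_distrib power2_norm_eq_inner)
  then have c2: "c\<^sup>2 < 1"
    using assms N by (simp add: zero_less_mult_iff)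
  then have c: "-1 < c" "c < 1"
    using abs_square_less_1[of c] by auto
  have "tan_half_angle a b = sin (arccos c) / (cos (arccos c) + 1)"
    unfolding tan_half_angle_def N_def[symmetric] c_def[symmetric]
    by (subst tan_half) simp
  also have "\<dots> = sqrt (1 - c\<^sup>2) / (c + 1)"
    using c by (simp add: sin_arccos)
  also have "\<dots> = (1 - c) / sqrt (1 - c\<^sup>2)"
  proof -
    have "sqrt (1 - c\<^sup>2) * sqrt (1 - c\<^sup>2) = (1 - c) * (c + 1)"
      using c2 by (simp add: power2_eq_square algebra_simps)
    then show ?thesis
      using c c2 by (simp add: frac_eq_eq)
  qed
  also have "\<dots> = (N - N * c) / sqrt (gram_det a b)"
  proof -
    have "sqrt (gram_det a b) = N * sqrt (1 - c\<^sup>2)"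
      using N by (simp add: D real_sqrt_mult)
    moreover have "N - N * c = N * (1 - c)"
      by (simp add: algebra_simps)
    ultimately show ?thesis
      using N by simp
  qed
  finally show ?thesis
    by (simp add: ab N_def)
qed

lemma tan_half_angle_equal_norm:
  assumes "norm u = norm v" and "u \<noteq> v" and "u \<noteq> - v"
  shows "tan_half_angle u v = norm (u - v) / norm (u + v)"
proof -
  have uv: "u \<bullet> u = v \<bullet> v"
    using assms(1) by (simp add: norm_eq)
  have pos: "norm (u - v) > 0" "norm (u + v) > 0"
    using assms(2,3) by (auto simp: eq_neg_iff_add_eq_0)
  have "gram_det (u + v) (u - v) = (norm (u + v) * norm (u - v))\<^sup>2"
    using uv by (simp add: gram_det_def power_mult_distrib power2_norm_eq_inner[symmetric]
        inner_diff inner_add inner_commute)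
  then have D: "gram_det u v = (norm (u + v) * norm (u - v) / 2)\<^sup>2"
    by (simp add: gram_det_sum_diff power_divide)
  have "norm u * norm v = u \<bullet> u"
    using assms(1) by (metis power2_norm_eq_inner power2_eq_square)
  then have "norm u * norm v - u \<bullet> v = norm (u - v) * norm (u - v) / 2"
    using uv by (simp add: power2_eq_square[symmetric] power2_norm_eq_inner inner_diff
        inner_commute)
  moreover have "gram_det u v > 0"
    using pos unfolding D by simp
  moreover have "sqrt (gram_det u v) = norm (u + v) * norm (u - v) / 2"
    using pos unfolding D by simp
  ultimately have "tan_half_angle u v =
      (norm (u - v) * norm (u - v) / 2) / (norm (u + v) * norm (u - v) / 2)"
    by (simp only: tan_half_angle_eq)
  then show ?thesis
    using pos by simp
qed

lemma tan_half_angle_pos: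
  assumes "gram_det a b > 0"
  shows "tan_half_angle a b > 0"
proof -
  have "(a \<bullet> b)\<^sup>2 < (norm a * norm b)\<^sup>2"
    using assms by (simp add: gram_det_def power_mult_distrib power2_norm_eq_inner)
  then have "a \<bullet> b < norm a * norm b"
    by (rule power_less_imp_less_base) simp
  then show ?thesis
    using assms by (simp add: tan_half_angle_eq)
qed

lemma tan_half_angle_minus_right: "tan_half_angle a (- b) = inverse (tan_half_angle a b)"
proof -
  have "\<bar>a \<bullet> b / (norm a * norm b)\<bar> \<le> 1"
    using Cauchy_Schwarz_ineq2[of a b] by (simp add: abs_mult divide_le_eq)
  then have "arccos (- (a \<bullet> b / (norm a * norm b))) = pi - arccos (a \<bullet> b / (norm a * norm b))"
    by (intro arccos_minus) linarith+
  then show ?thesis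
    by (simp add: tan_half_angle_def diff_divide_distrib tan_cot)
qed

lemma tan_half_angle_scaleR:
  assumes "s > 0" and "t > 0"
  shows "tan_half_angle (s *\<^sub>R a) (t *\<^sub>R b) = tan_half_angle a b"
  using assms by (simp add: tan_half_angle_def)

section \<open>Vectors of extremal stretching\<close>

lemma quadratic_nonneg_imp_linear_coeff_zero:
  fixes b c :: real
  assumes "\<And>t. 0 \<le> 2 * t * b + t\<^sup>2 * c"
  shows "b = 0"
proof (rule ccontr)
  assume "b \<noteq> 0"
  define k where "k = 1 + \<bar>c\<bar>"
  have k: "k > 0" "c < k"
    by (auto simp: k_def)
  have "2 * (- b / k) * b + (- b / k)\<^sup>2 * c = (b / k)\<^sup>2 * (c - 2 * k)"
    using k by (simp add: field_simps power2_eq_square)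
  moreover have "(b / k)\<^sup>2 * (c - 2 * k) < 0"
    using k \<open>b \<noteq> 0\<close> by (intro mult_pos_neg) auto
  ultimately show False
    using assms[of "- b / k"] by linarith
qed

text \<open>
  If \<open>\<parallel>f z\<parallel>\<^sup>2 - k \<parallel>z\<parallel>\<^sup>2\<close> has constant sign, its zeros are critical points, so the associated bilinear form
  vanishes there.
\<close>

lemma extremal_stretch_inner:
  fixes f :: "'a::real_inner \<Rightarrow> 'b::real_inner"
  assumes "linear f"
    and sign: "(\<forall>z. k * (norm z)\<^sup>2 \<le> (norm (f z))\<^sup>2) \<or> (\<forall>z. (norm (f z))\<^sup>2 \<le> k * (norm z)\<^sup>2)"
    and p: "(norm (f p))\<^sup>2 = k * (norm p)\<^sup>2"
  shows "f p \<bullet> f w = k * (p \<bullet> w)"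
proof -
  interpret linear f by fact
  define b where "b = f p \<bullet> f w - k * (p \<bullet> w)"
  define c where "c = f w \<bullet> f w - k * (w \<bullet> w)"
  have eq: "(norm (f (p + t *\<^sub>R w)))\<^sup>2 - k * (norm (p + t *\<^sub>R w))\<^sup>2 = 2 * t * b + t\<^sup>2 * c" for t
    using p unfolding power2_norm_eq_inner
    by (simp add: add scale inner_add inner_commute b_def c_def power2_eq_square algebra_simps)
  from sign have "b = 0"
  proof
    assume "\<forall>z. k * (norm z)\<^sup>2 \<le> (norm (f z))\<^sup>2"
    then have "0 \<le> 2 * t * b + t\<^sup>2 * c" for t
      using eq[of t] by (metis diff_ge_0_iff_ge)
    then show ?thesis
      by (rule quadratic_nonneg_imp_linear_coeff_zero)
  next
    assume "\<forall>z. (norm (f z))\<^sup>2 \<le> k * (norm z)\<^sup>2"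
    then have "2 * t * b + t\<^sup>2 * c \<le> 0" for t
      using eq[of t] by (metis diff_le_0_iff_le)
    then have "0 \<le> 2 * t * (- b) + t\<^sup>2 * (- c)" for t
      by (smt (verit) mult_minus_right)
    then have "- b = 0"
      by (rule quadratic_nonneg_imp_linear_coeff_zero)
    then show ?thesis by simp
  qed
  then show ?thesis
    by (simp add: b_def)
qed

section \<open>Half-angles under a linear map\<close>

text \<open>A linear map that stretches lengths by factors between \<open>m\<close> and \<open>M\<close>; the bounds need not be sharp.\<close>

locale linear_stretch_bounds = linear f
  for f :: "'a::real_inner \<Rightarrow> 'b::real_inner" +
  fixes m M :: real
  assumes m_pos: "m > 0"
    and lower: "m * norm z \<le> norm (f z)"
    and upper: "norm (f z) \<le> M * norm z"
begin

lemma eq_0_iff: "f z = 0 \<longleftrightarrow> z = 0"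
  using lower[of z] m_pos by (auto simp: zero mult_le_0_iff)

text \<open>
  The parallelogram spanned by the images has base \<open>\<parallel>f q\<parallel>\<close> and height \<open>\<parallel>f (p - c q)\<parallel>\<close>, and
  \<open>\<parallel>p - c q\<parallel> \<ge> \<parallel>p\<parallel>\<close> by Pythagoras. For \<open>q \<noteq> 0\<close> equality forces \<open>c = 0\<close>, that is, orthogonal images.
\<close>

lemma gram_det_image_ge:
  assumes "p \<bullet> q = 0"
  shows "(m * norm p * norm (f q))\<^sup>2 \<le> gram_det (f p) (f q)"
    and "gram_det (f p) (f q) = (m * norm p * norm (f q))\<^sup>2 \<Longrightarrow> q \<noteq> 0 \<Longrightarrow>
      norm (f p) = m * norm p \<and> f p \<bullet> f q = 0"
proof -
  define c where "c = f p \<bullet> f q / (f q \<bullet> f q)"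
  have D: "gram_det (f p) (f q) = (norm (f q) * norm (f (p - c *\<^sub>R q)))\<^sup>2" if "q \<noteq> 0"
    using gram_det_projection[of "f q" "f p"] that by (simp add: eq_0_iff c_def diff scale)
  have pyth: "(norm (p - c *\<^sub>R q))\<^sup>2 = (norm p)\<^sup>2 + (c * norm q)\<^sup>2"
    using assms by (simp add: power2_norm_eq_inner inner_diff inner_commute power_mult_distrib)
      (simp add: power2_eq_square)
  have proj: "norm p \<le> norm (p - c *\<^sub>R q)"
    by (rule power2_le_imp_le) (simp_all add: pyth)
  have low: "m * norm p \<le> norm (f (p - c *\<^sub>R q))"
    using mult_left_mono[OF proj less_imp_le[OF m_pos]] lower by (rule order_trans)
  show "(m * norm p * norm (f q))\<^sup>2 \<le> gram_det (f p) (f q)"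
  proof (cases "q = 0")
    case False
    have "m * norm p * norm (f q) \<le> norm (f q) * norm (f (p - c *\<^sub>R q))"
      using mult_right_mono[OF low norm_ge_zero[of "f q"]] by (simp add: mult.commute)
    then show ?thesis
      unfolding D[OF False] using m_pos by (intro power_mono) auto
  qed (simp add: gram_det_def zero)
  assume eq: "gram_det (f p) (f q) = (m * norm p * norm (f q))\<^sup>2" and "q \<noteq> 0"
  have "norm (f q) * norm (f (p - c *\<^sub>R q)) = m * norm p * norm (f q)"
    by (rule power2_eq_imp_eq[OF eq[unfolded D[OF \<open>q \<noteq> 0\<close>]]])
      (simp_all add: less_imp_le[OF m_pos])
  then have n: "norm (f (p - c *\<^sub>R q)) = m * norm p"
    using \<open>q \<noteq> 0\<close> by (simp add: eq_0_iff)
  then have "m * norm (p - c *\<^sub>R q) \<le> m * norm p"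
    using lower[of "p - c *\<^sub>R q"] by simp
  then have "norm (p - c *\<^sub>R q) = norm p"
    using proj m_pos by simp
  then have c: "c = 0"
    using pyth \<open>q \<noteq> 0\<close> by simp
  then have "f p \<bullet> f q = 0"
    using \<open>q \<noteq> 0\<close> by (simp add: c_def eq_0_iff)
  then show "norm (f p) = m * norm p \<and> f p \<bullet> f q = 0"
    using n c by simp
qed

context
  fixes u v :: 'a
  assumes norm_eq': "norm u = norm v" and ne: "u \<noteq> v" "u \<noteq> - v"
begin

lemma sum_diff_orthogonal: "(u + v) \<bullet> (u - v) = 0"
  using norm_eq' by (simp add: inner_add inner_diff inner_commute norm_eq)

lemma gram_det_image_pos: "gram_det (f u) (f v) > 0"
proof -
  have "u - v \<noteq> 0" "u + v \<noteq> 0"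
    using ne by (auto simp: eq_neg_iff_add_eq_0)
  then have "0 < (m * norm (u + v) * norm (f (u - v)))\<^sup>2"
    using m_pos eq_0_iff by simp
  also have "\<dots> \<le> gram_det (f (u + v)) (f (u - v))"
    by (rule gram_det_image_ge(1)[OF sum_diff_orthogonal])
  finally show ?thesis
    by (simp add: add diff gram_det_sum_diff)
qed

lemma
  shows tan_half_angle_linear_image_le:
      "tan_half_angle (f u) (f v) \<le> M / m * tan_half_angle u v" (is ?le)
    and tan_half_angle_linear_image_eq_iff:
      "tan_half_angle (f u) (f v) = M / m * tan_half_angle u v \<longleftrightarrow>
        norm (f (u + v)) = m * norm (u + v) \<and> norm (f (u - v)) = M * norm (u - v)" (is ?eq)
proof -
  define p q where "p = u + v" and "q = u - v"
  have q0: "q \<noteq> 0" and p0: "p \<noteq> 0"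
    using ne by (auto simp: p_def q_def eq_neg_iff_add_eq_0)
  have pq: "p \<bullet> q = 0"
    unfolding p_def q_def by (rule sum_diff_orthogonal)
  define D where "D = gram_det (f p) (f q)"
  have D4: "D = 4 * gram_det (f u) (f v)"
    by (simp add: D_def p_def q_def add diff gram_det_sum_diff)
  have Dpos: "D > 0"
    using gram_det_image_pos by (simp add: D4)
  have fq: "norm (f q) > 0" and np: "norm p > 0"
    using q0 p0 eq_0_iff by auto
  have sq: "(norm (f q))\<^sup>2 = (norm (f u))\<^sup>2 + (norm (f v))\<^sup>2 - 2 * (f u \<bullet> f v)"
    by (simp add: q_def diff power2_norm_eq_inner inner_diff inner_commute)
  \<comment> \<open>The arithmetic-geometric mean inequality for \<open>\<parallel>f u\<parallel>\<close> and \<open>\<parallel>f v\<parallel>\<close>.\<close>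
  have numerator: "2 * (norm (f u) * norm (f v) - f u \<bullet> f v) \<le> (norm (f q))\<^sup>2"
    using sum_squares_bound[of "norm (f u)" "norm (f v)"] sq by simp
  have sqrt_D: "sqrt D = 2 * sqrt (gram_det (f u) (f v))"
    by (simp add: D4 real_sqrt_mult)
  have T: "tan_half_angle (f u) (f v) = 2 * (norm (f u) * norm (f v) - f u \<bullet> f v) / sqrt D"
    unfolding tan_half_angle_eq[OF gram_det_image_pos] sqrt_D
    by (simp only: mult_divide_mult_cancel_left)
  have step1: "tan_half_angle (f u) (f v) \<le> (norm (f q))\<^sup>2 / sqrt D"
    unfolding T using numerator Dpos by (intro divide_right_mono) auto
  have root: "m * norm p * norm (f q) \<le> sqrt D"
    using gram_det_image_ge(1)[OF pq] real_le_rsqrt by (auto simp: D_def)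
  have mpq: "m * norm p * norm (f q) > 0"
    using m_pos np fq by simp
  have "(norm (f q))\<^sup>2 / sqrt D \<le> (norm (f q))\<^sup>2 / (m * norm p * norm (f q))"
    using root mpq Dpos by (intro divide_left_mono mult_pos_pos[of "sqrt D"]) simp_all
  also have cancel: "\<dots> = norm (f q) / (m * norm p)"
    using fq by (simp add: power2_eq_square)
  finally have step2: "(norm (f q))\<^sup>2 / sqrt D \<le> norm (f q) / (m * norm p)" .
  have step3: "norm (f q) / (m * norm p) \<le> M * norm q / (m * norm p)"
    using upper m_pos np by (intro divide_right_mono) auto
  have rhs: "M / m * tan_half_angle u v = M * norm q / (m * norm p)"
    using tan_half_angle_equal_norm[OF norm_eq' ne] by (simp add: p_def q_def)
  show ?le
    using step1 step2 step3 rhs by linarith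
  \<comment> \<open>If the outer terms of the chain agree, then so do the terms in each step.\<close>
  have "norm (f p) = m * norm p \<and> norm (f q) = M * norm q"
    if eq: "tan_half_angle (f u) (f v) = M / m * tan_half_angle u v"
  proof
    have "norm (f q) / (m * norm p) = M * norm q / (m * norm p)"
      using step1 step2 step3 rhs eq by linarith
    then show "norm (f q) = M * norm q"
      using m_pos np by simp
    have "(norm (f q))\<^sup>2 / sqrt D = (norm (f q))\<^sup>2 / (m * norm p * norm (f q))"
      using step1 step2 step3 rhs eq cancel by linarith
    then have "sqrt D = m * norm p * norm (f q)"
      using fq mpq Dpos by (simp add: frac_eq_eq)
    then have "D = (m * norm p * norm (f q))\<^sup>2"
      using Dpos by (metis less_imp_le real_sqrt_pow2)
    then show "norm (f p) = m * norm p"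
      using gram_det_image_ge(2)[OF pq _ q0] by (simp add: D_def)
  qed
  moreover have "tan_half_angle (f u) (f v) = M / m * tan_half_angle u v"
    if fp: "norm (f p) = m * norm p" and fqM: "norm (f q) = M * norm q"
  proof -
    have "f p \<bullet> f q = m\<^sup>2 * (p \<bullet> q)"
    proof (rule extremal_stretch_inner)
      show "linear f" by (rule linear_axioms)
      show "(norm (f p))\<^sup>2 = m\<^sup>2 * (norm p)\<^sup>2"
        by (simp add: fp power_mult_distrib)
      have "m\<^sup>2 * (norm z)\<^sup>2 \<le> (norm (f z))\<^sup>2" for z
        using power_mono[OF lower[of z], of 2] m_pos by (simp add: power_mult_distrib)
      then show "(\<forall>z. m\<^sup>2 * (norm z)\<^sup>2 \<le> (norm (f z))\<^sup>2) \<or> (\<forall>z. (norm (f z))\<^sup>2 \<le> m\<^sup>2 * (norm z)\<^sup>2)"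
        by blast
    qed
    then have orth: "f p \<bullet> f q = 0"
      by (simp add: pq)
    \<comment> \<open>Orthogonality of the images of the diagonals means that \<open>f u\<close> and \<open>f v\<close> again have equal norm.\<close>
    then have n: "norm (f u) = norm (f v)"
      by (simp add: p_def q_def add diff inner_add inner_diff inner_commute norm_eq)
    have "f u \<noteq> f v" "f u \<noteq> - f v"
      using p0 q0 eq_0_iff[of p] eq_0_iff[of q]
      by (auto simp: p_def q_def add diff)
    from tan_half_angle_equal_norm[OF n this]
    have "tan_half_angle (f u) (f v) = norm (f q) / norm (f p)"
      by (simp add: p_def q_def add diff)
    then show ?thesis
      by (simp only: rhs fp fqM)
  qed
  ultimately show ?eq
    unfolding p_def q_def by blast
qed

end

end

section \<open>The operator norm and the spectrum of the Gram matrix\<close>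

lemma onorm_attained:
  fixes f :: "'a::euclidean_space \<Rightarrow> 'b::real_normed_vector"
  assumes "bounded_linear f"
  obtains z where "norm z = 1" and "norm (f z) = onorm f"
proof -
  interpret bounded_linear f by fact
  have "continuous_on (sphere 0 1) (\<lambda>z. norm (f z))"
    by (intro continuous_intros linear_continuous_on assms)
  then obtain z where z: "z \<in> sphere 0 1" and max: "\<forall>w\<in>sphere 0 1. norm (f w) \<le> norm (f z)"
    using continuous_attains_sup[of "sphere 0 1" "\<lambda>z. norm (f z)"] by auto
  have "norm (f w) \<le> norm (f z) * norm w" for w
  proof (cases "w = 0")
    case False
    have "norm (f (sgn w)) \<le> norm (f z)"
      using max False by (simp add: norm_sgn)
    then show ?thesis
      using False by (simp add: sgn_div_norm scaleR field_simps)
  qed (simp add: zero)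
  then have "onorm f \<le> norm (f z)"
    by (intro onorm_bound) auto
  moreover have "norm (f z) \<le> onorm f"
    using onorm[OF assms, of z] z by simp
  ultimately show ?thesis
    using that z by simp
qed

lemma Re_cinner: "Re (cinner x y) = x \<bullet> y"
  by (simp add: cinner_def inner_vec_def inner_complex_def algebra_simps)

lemma tan_angle_half: "tan (angle x y / 2) = tan_half_angle x y"
  by (simp add: angle_def tan_half_angle_def Re_cinner)

lemma of_real_vector_scalar_mult:
  fixes v :: "complex ^ 'n"
  shows "complex_of_real r *s v = r *\<^sub>R v"
  by (simp add: vec_eq_iff) (simp add: scaleR_conv_of_real)

lemma inner_conj_transpose_mult: "((conj_transpose A ** A) *v v) \<bullet> w = (A *v v) \<bullet> (A *v w)"
  by (simp add: Re_cinner[symmetric] matrix_vector_mul_assoc[symmetric] cinner_conj_transpose)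

lemma eigenspace_Gram_iff:
  "v \<in> eigenspace (conj_transpose A ** A) (complex_of_real r) \<longleftrightarrow>
    (\<forall>w. (A *v v) \<bullet> (A *v w) = r * (v \<bullet> w))"
proof -
  have "v \<in> eigenspace (conj_transpose A ** A) (complex_of_real r) \<longleftrightarrow>
      (\<forall>w. ((conj_transpose A ** A) *v v) \<bullet> w = (r *\<^sub>R v) \<bullet> w)"
    unfolding vector_eq_rdot by (simp add: eigenspace_def of_real_vector_scalar_mult)
  then show ?thesis
    by (simp add: inner_conj_transpose_mult)
qed

text \<open>
  Eigenvectors for distinct eigenvalues are orthogonal, hence linearly independent over the reals, so
  their number is bounded by the dimension. Finiteness is what makes the maximum and the minimum of
  the set of eigenvalues meaningful.
\<close>

lemma finite_eigenvalues_Gram: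
  fixes A :: "complex ^ 'n ^ 'n"
  shows "finite {r. eigenvalue (conj_transpose A ** A) (complex_of_real r)}" (is "finite ?E")
proof -
  have "\<forall>r\<in>?E. \<exists>v. v \<noteq> 0 \<and> (\<forall>w. (A *v v) \<bullet> (A *v w) = r * (v \<bullet> w))"
    by (auto simp: eigenvalue_def eigenspace_Gram_iff)
  then obtain e where e: "\<And>r. r \<in> ?E \<Longrightarrow> e r \<noteq> 0"
      "\<And>r w. r \<in> ?E \<Longrightarrow> (A *v e r) \<bullet> (A *v w) = r * (e r \<bullet> w)"
    by metis
  have orth: "e r \<bullet> e s = 0" if "r \<in> ?E" "s \<in> ?E" "r \<noteq> s" for r s
  proof -
    have "r * (e r \<bullet> e s) = s * (e r \<bullet> e s)"
      using e(2)[OF that(1), of "e s"] e(2)[OF that(2), of "e r"] by (simp add: inner_commute)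
    then show ?thesis
      using that(3) by simp
  qed
  have "inj_on e ?E"
    using orth e(1) by (intro inj_onI) (metis inner_eq_zero_iff)
  moreover have "finite (e ` ?E)"
  proof -
    have "pairwise orthogonal (e ` ?E)"
      using orth by (auto simp: pairwise_def orthogonal_def)
    moreover have "0 \<notin> e ` ?E"
      using e(1) by (metis imageE)
    ultimately show ?thesis
      using pairwise_orthogonal_independent independent_bound by blast
  qed
  ultimately show ?thesis
    by (metis finite_imageD)
qed

text \<open>
  By \<open>extremal_stretch_inner\<close>, the vectors that attain a lower or upper stretching bound \<open>k\<close> are
  precisely the vectors \<open>v\<close> with \<open>A\<^sup>* A v = k\<^sup>2 v\<close>.
\<close>

lemma eigenspace_Gram_extremal_iff:
  fixes A :: "complex ^ 'n ^ 'n"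
  assumes "k \<ge> 0"
    and "(\<forall>z. k * norm z \<le> norm (A *v z)) \<or> (\<forall>z. norm (A *v z) \<le> k * norm z)"
  shows "v \<in> eigenspace (conj_transpose A ** A) (complex_of_real (k\<^sup>2)) \<longleftrightarrow>
    norm (A *v v) = k * norm v"
proof
  assume "v \<in> eigenspace (conj_transpose A ** A) (complex_of_real (k\<^sup>2))"
  then have "(A *v v) \<bullet> (A *v v) = k\<^sup>2 * (v \<bullet> v)"
    unfolding eigenspace_Gram_iff by blast
  then have "(norm (A *v v))\<^sup>2 = (k * norm v)\<^sup>2"
    by (simp add: power2_norm_eq_inner power_mult_distrib)
  then show "norm (A *v v) = k * norm v"
    by (rule power2_eq_imp_eq) (simp_all add: assms(1))
next
  assume v: "norm (A *v v) = k * norm v"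
  have "(\<forall>z. k\<^sup>2 * (norm z)\<^sup>2 \<le> (norm (A *v z))\<^sup>2) \<or> (\<forall>z. (norm (A *v z))\<^sup>2 \<le> k\<^sup>2 * (norm z)\<^sup>2)"
    using assms unfolding power_mult_distrib[symmetric]
    by (meson mult_nonneg_nonneg norm_ge_zero power_mono)
  moreover have "(norm (A *v v))\<^sup>2 = k\<^sup>2 * (norm v)\<^sup>2"
    by (simp add: v power_mult_distrib)
  ultimately have "\<forall>w. (A *v v) \<bullet> (A *v w) = k\<^sup>2 * (v \<bullet> w)"
    using extremal_stretch_inner[of "(*v) A" "k\<^sup>2" v] by auto
  then show "v \<in> eigenspace (conj_transpose A ** A) (complex_of_real (k\<^sup>2))"
    unfolding eigenspace_Gram_iff .
qed

lemma eigenvalue_Gram_stretch: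
  assumes "eigenvalue (conj_transpose A ** A) (complex_of_real r)"
  obtains v where "norm v > 0" and "(norm (A *v v))\<^sup>2 = r * (norm v)\<^sup>2"
proof -
  obtain v where v: "v \<noteq> 0" "\<forall>w. (A *v v) \<bullet> (A *v w) = r * (v \<bullet> w)"
    using assms by (auto simp: eigenvalue_def eigenspace_Gram_iff)
  show ?thesis
    by (rule that[of v]) (simp_all add: v power2_norm_eq_inner)
qed

lemma max_eigenvalue_Gram:
  fixes A :: "complex ^ 'n ^ 'n"
  shows "max_eigenvalue (conj_transpose A ** A) = (onorm ((*v) A))\<^sup>2"
  unfolding max_eigenvalue_def
proof (rule Max_eqI)
  have bl: "bounded_linear ((*v) A)" by simp
  note up = onorm[OF bl]
  show "finite {r. eigenvalue (conj_transpose A ** A) (complex_of_real r)}"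
    by (rule finite_eigenvalues_Gram)
  show "r \<le> (onorm ((*v) A))\<^sup>2"
    if r: "r \<in> {r. eigenvalue (conj_transpose A ** A) (complex_of_real r)}" for r
  proof -
    obtain v where v: "norm v > 0" "(norm (A *v v))\<^sup>2 = r * (norm v)\<^sup>2"
      using r eigenvalue_Gram_stretch by blast
    have "r * (norm v)\<^sup>2 \<le> (onorm ((*v) A))\<^sup>2 * (norm v)\<^sup>2"
      using power_mono[OF up[of v], of 2] v by (simp add: power_mult_distrib)
    then show ?thesis
      using v(1) by simp
  qed
  obtain z where z: "norm z = 1" "norm (A *v z) = onorm ((*v) A)"
    using onorm_attained[OF bl] by blast
  then have "z \<in> eigenspace (conj_transpose A ** A) (complex_of_real ((onorm ((*v) A))\<^sup>2))"
    using up onorm_pos_le[OF bl] by (subst eigenspace_Gram_extremal_iff) auto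
  moreover have "z \<noteq> 0"
    using z(1) by auto
  ultimately show "(onorm ((*v) A))\<^sup>2 \<in> {r. eigenvalue (conj_transpose A ** A) (complex_of_real r)}"
    unfolding eigenvalue_def by blast
qed

lemma matrix_inv_mult_cancel:
  fixes A :: "complex ^ 'n ^ 'n"
  assumes "invertible A"
  shows "matrix_inv A *v (A *v z) = z" and "A *v (matrix_inv A *v z) = z"
proof -
  have "A ** matrix_inv A = mat 1 \<and> matrix_inv A ** A = mat 1"
    using assms unfolding invertible_def matrix_inv_def by (rule someI_ex)
  then show "matrix_inv A *v (A *v z) = z" and "A *v (matrix_inv A *v z) = z"
    by (simp_all add: matrix_vector_mul_assoc)
qed

lemma onorm_matrix_inv_pos:
  fixes A :: "complex ^ 'n ^ 'n"
  assumes "invertible A"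
  shows "onorm ((*v) (matrix_inv A)) > 0"
proof -
  have bl: "bounded_linear ((*v) (matrix_inv A))" by simp
  have "matrix_inv A *v (A *v axis undefined 1) \<noteq> 0"
    unfolding matrix_inv_mult_cancel[OF assms] by (simp add: axis_eq_0_iff)
  then have "(*v) (matrix_inv A) \<noteq> (\<lambda>_. 0)"
    by metis
  then show ?thesis
    using onorm_pos_lt[OF bl] by auto
qed

lemma inverse_onorm_matrix_inv_le:
  fixes A :: "complex ^ 'n ^ 'n"
  assumes "invertible A"
  shows "inverse (onorm ((*v) (matrix_inv A))) * norm z \<le> norm (A *v z)"
proof -
  have bl: "bounded_linear ((*v) (matrix_inv A))" by simp
  have "norm z \<le> onorm ((*v) (matrix_inv A)) * norm (A *v z)"
    using onorm[OF bl, of "A *v z"] by (simp add: matrix_inv_mult_cancel[OF assms])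
  then show ?thesis
    using onorm_matrix_inv_pos[OF assms] by (simp add: field_simps)
qed

lemma min_eigenvalue_Gram:
  fixes A :: "complex ^ 'n ^ 'n"
  assumes "invertible A"
  shows "min_eigenvalue (conj_transpose A ** A) = (inverse (onorm ((*v) (matrix_inv A))))\<^sup>2"
  unfolding min_eigenvalue_def
proof (rule Min_eqI)
  define m where "m = inverse (onorm ((*v) (matrix_inv A)))"
  have m: "m > 0"
    using onorm_matrix_inv_pos[OF assms] by (simp add: m_def)
  have low: "m * norm z \<le> norm (A *v z)" for z
    unfolding m_def by (rule inverse_onorm_matrix_inv_le[OF assms])
  show "finite {r. eigenvalue (conj_transpose A ** A) (complex_of_real r)}"
    by (rule finite_eigenvalues_Gram)
  show "(inverse (onorm ((*v) (matrix_inv A))))\<^sup>2 \<le> r"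
    if r: "r \<in> {r. eigenvalue (conj_transpose A ** A) (complex_of_real r)}" for r
  proof -
    obtain v where v: "norm v > 0" "(norm (A *v v))\<^sup>2 = r * (norm v)\<^sup>2"
      using r eigenvalue_Gram_stretch by blast
    have "m\<^sup>2 * (norm v)\<^sup>2 \<le> r * (norm v)\<^sup>2"
      using power_mono[OF low[of v], of 2] m v by (simp add: power_mult_distrib)
    then show ?thesis
      using v(1) by (simp add: m_def)
  qed
  have bl: "bounded_linear ((*v) (matrix_inv A))" by simp
  obtain w where w: "norm w = 1" "norm (matrix_inv A *v w) = onorm ((*v) (matrix_inv A))"
    using onorm_attained[OF bl] by blast
  define z where "z = matrix_inv A *v w"
  have "norm (A *v z) = m * norm z" "z \<noteq> 0"
    using w onorm_matrix_inv_pos[OF assms]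
    by (auto simp: z_def m_def matrix_inv_mult_cancel[OF assms])
  then have "z \<in> eigenspace (conj_transpose A ** A) (complex_of_real (m\<^sup>2))"
    using low m by (subst eigenspace_Gram_extremal_iff) auto
  then show "(inverse (onorm ((*v) (matrix_inv A))))\<^sup>2
      \<in> {r. eigenvalue (conj_transpose A ** A) (complex_of_real r)}"
    using \<open>z \<noteq> 0\<close> unfolding eigenvalue_def m_def by blast
qed

section \<open>The angle inequality\<close>

theorem theorem3p1:
  fixes A :: "complex ^ 'n ^ 'n" and x y :: "complex ^ 'n"
  assumes "invertible A"
    and "x \<noteq> y" and "vec.independent {x, y}"
  shows "let \<phi> = angle x y;
             \<psi> = angle (A *v x) (A *v y);
             \<kappa> = condition_number A;
             H = conj_transpose A ** A;
             l_min = complex_of_real (min_eigenvalue H);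
             l_max = complex_of_real (max_eigenvalue H)
         in inverse \<kappa> * tan (\<phi> / 2) \<le> tan (\<psi> / 2)
          \<and> tan (\<psi> / 2) \<le> \<kappa> * tan (\<phi> / 2)
          \<and> (tan (\<psi> / 2) = \<kappa> * tan (\<phi> / 2) \<longleftrightarrow>
               x /\<^sub>R norm x + y /\<^sub>R norm y \<in> eigenspace H l_min
             \<and> x /\<^sub>R norm x - y /\<^sub>R norm y \<in> eigenspace H l_max)
          \<and> (inverse \<kappa> * tan (\<phi> / 2) = tan (\<psi> / 2) \<longleftrightarrow>
               x /\<^sub>R norm x - y /\<^sub>R norm y \<in> eigenspace H l_min
             \<and> x /\<^sub>R norm x + y /\<^sub>R norm y \<in> eigenspace H l_max)"
proof -
  define u v where "u = sgn x" and "v = sgn y"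
  have xy: "x \<noteq> 0" "y \<noteq> 0"
    using assms(3) vec.dependent_zero by auto
  have nuv: "norm u = norm v"
    using xy by (simp add: u_def v_def norm_sgn)
  have x_notin: "x \<notin> vec.span {y}"
    using assms(2,3) by (simp add: vec.independent_insert)
  have not_parallel: "x \<noteq> c *\<^sub>R y" for c
    using x_notin vec.span_scale[OF vec.span_base[of y "{y}"], of "complex_of_real c"]
    by (auto simp: of_real_vector_scalar_mult)
  have x_eq: "x = norm x *\<^sub>R u" and v_eq: "v = inverse (norm y) *\<^sub>R y"
    using xy by (simp_all add: u_def v_def sgn_div_norm)
  have multiple: "x = (norm x * c * inverse (norm y)) *\<^sub>R y" if "u = c *\<^sub>R v" for c
    by (subst x_eq) (simp add: that v_eq)
  then have "u \<noteq> c *\<^sub>R v" for c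
    using not_parallel by blast
  from this[of 1] this[of "- 1"] have ne: "u \<noteq> v" "u \<noteq> - v"
    by simp_all
  define M m where "M = onorm ((*v) A)" and "m = inverse (onorm ((*v) (matrix_inv A)))"
  have bl: "bounded_linear ((*v) A)" by simp
  interpret linear_stretch_bounds "(*v) A" m M
  proof
    show "m > 0"
      using onorm_matrix_inv_pos[OF assms(1)] by (simp add: m_def)
    show "m * norm z \<le> norm (A *v z)" for z
      unfolding m_def by (rule inverse_onorm_matrix_inv_le[OF assms(1)])
    show "norm (A *v z) \<le> M * norm z" for z
      unfolding M_def by (rule onorm[OF bl])
  qed (simp_all add: matrix_vector_right_distrib linear_scale)
  define t T where "t = tan_half_angle u v" and "T = tan_half_angle (A *v u) (A *v v)"
  have \<phi>: "tan (angle x y / 2) = t"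
    unfolding tan_angle_half t_def u_def v_def sgn_div_norm
    using xy by (simp add: tan_half_angle_scaleR)
  have \<psi>: "tan (angle (A *v x) (A *v y) / 2) = T"
    unfolding tan_angle_half T_def u_def v_def sgn_div_norm scale
    using xy by (simp add: tan_half_angle_scaleR)
  have \<kappa>: "condition_number A = M / m"
    by (simp add: condition_number_def M_def m_def divide_inverse)
  have Tpos: "T > 0"
    unfolding T_def by (rule tan_half_angle_pos[OF gram_det_image_pos[OF nuv ne]])
  have tpos: "t > 0"
    unfolding t_def tan_half_angle_equal_norm[OF nuv ne]
    using ne by (auto simp: eq_neg_iff_add_eq_0)
  have le: "T \<le> M / m * t"
    unfolding T_def t_def by (rule tan_half_angle_linear_image_le[OF nuv ne])
  have \<kappa>pos: "M / m > 0"
    using le Tpos tpos by (metis less_le_trans zero_less_mult_pos2)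
  have eq: "T = M / m * t \<longleftrightarrow>
      norm (A *v (u + v)) = m * norm (u + v) \<and> norm (A *v (u - v)) = M * norm (u - v)"
    unfolding T_def t_def by (rule tan_half_angle_linear_image_eq_iff[OF nuv ne])
  \<comment> \<open>The left-hand inequality comes from the pair \<open>u\<close>, \<open>-v\<close>, whose half-angles are complementary.\<close>
  have nuv': "norm u = norm (- v)" and ne': "u \<noteq> - v" "u \<noteq> - (- v)"
    using nuv ne by auto
  have Tt': "tan_half_angle (A *v u) (A *v (- v)) = inverse T" "tan_half_angle u (- v) = inverse t"
    by (simp_all add: neg tan_half_angle_minus_right T_def t_def)
  have le': "inverse T \<le> M / m * inverse t"
    using tan_half_angle_linear_image_le[OF nuv' ne'] by (simp only: Tt')
  have eq': "inverse T = M / m * inverse t \<longleftrightarrow>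
      norm (A *v (u - v)) = m * norm (u - v) \<and> norm (A *v (u + v)) = M * norm (u + v)"
    using tan_half_angle_linear_image_eq_iff[OF nuv' ne'] by (simp only: Tt') simp
  have invert: "inverse k * t \<le> T \<longleftrightarrow> inverse T \<le> k * inverse t"
      "inverse k * t = T \<longleftrightarrow> inverse T = k * inverse t" if "k > 0" for k
    using that Tpos tpos by (auto simp: field_simps)
  have max_iff: "z \<in> eigenspace (conj_transpose A ** A)
        (complex_of_real (max_eigenvalue (conj_transpose A ** A))) \<longleftrightarrow>
      norm (A *v z) = M * norm z" for z
    unfolding max_eigenvalue_Gram M_def[symmetric]
    using upper onorm_pos_le[OF bl] by (intro eigenspace_Gram_extremal_iff) (auto simp: M_def)
  have min_iff: "z \<in> eigenspace (conj_transpose A ** A)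
        (complex_of_real (min_eigenvalue (conj_transpose A ** A))) \<longleftrightarrow>
      norm (A *v z) = m * norm z" for z
    unfolding min_eigenvalue_Gram[OF assms(1)] m_def[symmetric]
    using lower m_pos by (intro eigenspace_Gram_extremal_iff) auto
  show ?thesis
    unfolding Let_def \<phi> \<psi> \<kappa> max_iff min_iff sgn_div_norm[symmetric] u_def[symmetric] v_def[symmetric]
    using le le' eq eq' by (simp only: invert[OF \<kappa>pos] simp_thms)
qed

end
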